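(* Let $X_1,\dots,X_n\in\mathcal{M}(R,M)$ be measures with labels $Z_1,\dots,Z_n\in\{1,\dots,L\}$. (1) Assume that $X_1,\dots,X_n$ is $w$-concentrated. If $\Psi:\mathbb{R}^+\to\mathbb{R}^+$ is $1$-Lipschitz, then for all $\mathbf{c}\in\mathcal{B}(0,R)^k$, all $\sigma>0$, and all $i_1,i_2\in\{1,\dots,n\}$ such that $Z_{i_1}=Z_{i_2}$, $$\|v_{\mathbf{c},\sigma}(X_{i_1})-v_{\mathbf{c},\sigma}(X_{i_2})\|_\infty\le\frac{w}{\sigma}.$$ (2) Therefore, if $X_1,\dots,X_n$ is $(p,r,\Delta)$-shattered by $\mathbf{c}\in\mathcal{B}(0,R)^k$ (with $p\in\mathbb{N}^*$, $r>0$, $\Delta\ge0$) and is $(r\Delta/4)$-concentrated, then for any $(p,\delta)$-kernel function $\Psi$ with $\delta\le\frac{\Delta}{4M}$ and any $\sigma\in[r,2r]$, for all $i_1,i_2$, $$Z_{i_1}=Z_{i_2}\ \Rightarrow\ \|v_{\mathbf{c},\sigma}(X_{i_1})-v_{\mathbf{c},\sigma}(X_{i_2})\|_\infty\le\frac{\Delta}{4},$$ $$Z_{i_1}\neq Z_{i_2}\ \Rightarrow\ \|v_{\mathbf{c},\sigma}(X_{i_1})-v_{\mathbf{c},\sigma}(X_{i_2})\|_\infty\ge\frac{\Delta}{2}.$$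
   Context: $\mathcal{B}(x,r)$ is the (closed) Euclidean ball of $\mathbb{R}^d$. $\mathcal{M}(R,M)$ is the set of (nonnegative) Borel measures on $\mathcal{B}(0,R)\subset\mathbb{R}^d$ with total mass at most $M$. Kernel functions: for $(p,\delta)\in\mathbb{N}^*\times[0,1/2]$, a function $\psi:\mathbb{R}^+\to\mathbb{R}^+$ is a $(p,\delta)$-kernel function if (i) $\|\psi\|_\infty\le 1$; (ii) $\inf_{0\le u\le 1/p}\psi(u)\ge 1-\delta$; (iii) $\sup_{u>2p}\psi(u)\le\delta$; (iv) $\psi$ is $1$-Lipschitz. Vectorization: for $\mathbf{c}=(c_1,\dots,c_k)$ and $\sigma>0$, $v_{\mathbf{c},\sigma}(\mu)=\left(\int\Psi(\|u-c_1\|/\sigma)\,\mu(du),\dots,\int\Psi(\|u-c_k\|/\sigma)\,\mu(du)\right)$ for $\mu\in\mathcal{M}(R,M)$. Shattering: $\mathbf{c}$ is said to $(p,r,\Delta)$-shatter $X_1,\dots,X_n$ if for any $i_1,i_2$ with $Z_{i_1}\neq Z_{i_2}$ there exists $j\in\{1,\dots,k\}$ such that $X_{i_1}(\mathcal{B}(c_j,r/p))\ge X_{i_2}(\mathcal{B}(c_j,4pr))+\Delta$ or $X_{i_2}(\mathcal{B}(c_j,r/p))\ge X_{i_1}(\mathcal{B}(c_j,4pr))+\Delta$. Concentration: the sample $X_1,\dots,X_n$ is $w$-concentrated if for all $i_1,i_2$ with $Z_{i_1}=Z_{i_2}$: $X_{i_1}(\mathbb{R}^d)=X_{i_2}(\mathbb{R}^d)$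 and $W_1(X_{i_1},X_{i_2})\le w$. Here, for measures $\mu_1,\mu_2$ of the same total mass, $W_1(\mu_1,\mu_2)=\inf_\pi\int\|x-y\|\,\pi(dx,dy)$ over measures $\pi$ on $\mathbb{R}^d\times\mathbb{R}^d$ with marginals $\mu_1,\mu_2$ (no normalization of mass). *)

theory Defs
  imports "HOL-Analysis.Analysis"
begin

text \<open>A Borel measure on the closed ball is represented by its extension by zero to the whole
  space, so that the mass of balls and of the whole space can be taken directly.\<close>

definition ball_measures :: "real \<Rightarrow> real \<Rightarrow> 'a::euclidean_space measure set" where
  "ball_measures R M =
     {\<mu>. sets \<mu> = sets borel \<and> finite_measure \<mu> \<and>
         emeasure \<mu> (- cball 0 R) = 0 \<and> measure \<mu> UNIV \<le> M}"

text \<open>Functions from the nonnegative reals to themselves are functions on \<^typ>\<open>real\<close> that are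
  only constrained on \<^term>\<open>{0::real..}\<close>. The bounds on suprema and infima are stated
  pointwise, since the conditionally complete \<^const>\<open>Sup\<close> on the reals is unspecified on
  unbounded sets.\<close>

definition kernel_function :: "nat \<Rightarrow> real \<Rightarrow> (real \<Rightarrow> real) \<Rightarrow> bool" where
  "kernel_function p \<delta> \<psi> \<longleftrightarrow>
     1 \<le> p \<and> 0 \<le> \<delta> \<and> \<delta> \<le> 1/2 \<and>
     (\<forall>u\<ge>0. 0 \<le> \<psi> u) \<and>
     (\<forall>u\<ge>0. \<bar>\<psi> u\<bar> \<le> 1) \<and>
     (\<forall>u. 0 \<le> u \<and> u \<le> 1 / real p \<longrightarrow> 1 - \<delta> \<le> \<psi> u) \<and>
     (\<forall>u. 2 * real p < u \<longrightarrow> \<psi> u \<le> \<delta>) \<and>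
     1-lipschitz_on {0..} \<psi>"

definition vectorization ::
    "(real \<Rightarrow> real) \<Rightarrow> 'a::euclidean_space ^ 'k \<Rightarrow> real \<Rightarrow> 'a measure \<Rightarrow> real ^ 'k" where
  "vectorization \<psi> c \<sigma> \<mu> = (\<chi> j. \<integral>u. \<psi> (norm (u - c $ j) / \<sigma>) \<partial>\<mu>)"

definition couplings ::
    "'a::euclidean_space measure \<Rightarrow> 'a measure \<Rightarrow> ('a \<times> 'a) measure set" where
  "couplings \<mu> \<nu> =
     {\<pi>. sets \<pi> = sets borel \<and> distr \<pi> borel fst = \<mu> \<and> distr \<pi> borel snd = \<nu>}"

text \<open>No normalization of the mass; the value is \<^term>\<open>top :: ennreal\<close> if the masses differ.\<close>

definition W1 :: "'a::euclidean_space measure \<Rightarrow> 'a measure \<Rightarrow> ennreal" where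
  "W1 \<mu> \<nu> = (INF \<pi>\<in>couplings \<mu> \<nu>. \<integral>\<^sup>+z. ennreal (norm (fst z - snd z)) \<partial>\<pi>)"

definition shatters ::
    "nat \<Rightarrow> real \<Rightarrow> real \<Rightarrow> 'a::euclidean_space ^ 'k \<Rightarrow> nat \<Rightarrow> (nat \<Rightarrow> 'a measure) \<Rightarrow> (nat \<Rightarrow> nat) \<Rightarrow> bool"
where
  "shatters p r \<Delta> c n X Z \<longleftrightarrow>
     (\<forall>i1\<in>{1..n}. \<forall>i2\<in>{1..n}. Z i1 \<noteq> Z i2 \<longrightarrow>
       (\<exists>j. measure (X i1) (cball (c $ j) (r / real p))
              \<ge> measure (X i2) (cball (c $ j) (4 * real p * r)) + \<Delta> \<or>
            measure (X i2) (cball (c $ j) (r / real p))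
              \<ge> measure (X i1) (cball (c $ j) (4 * real p * r)) + \<Delta>))"

text \<open>The comparison is made in \<^typ>\<open>ereal\<close> because \<^const>\<open>ennreal\<close> would truncate a
  negative \<open>w\<close> to zero.\<close>

definition concentrated ::
    "real \<Rightarrow> nat \<Rightarrow> (nat \<Rightarrow> 'a::euclidean_space measure) \<Rightarrow> (nat \<Rightarrow> nat) \<Rightarrow> bool" where
  "concentrated w n X Z \<longleftrightarrow>
     (\<forall>i1\<in>{1..n}. \<forall>i2\<in>{1..n}. Z i1 = Z i2 \<longrightarrow>
       emeasure (X i1) UNIV = emeasure (X i2) UNIV \<and>
       enn2ereal (W1 (X i1) (X i2)) \<le> ereal w)"

end

theory Submission
  imports Defs
begin

text \<open>A coordinate of the vectorization integrates the profile
  \<open>u \<mapsto> \<psi> (norm (u - c) / \<sigma>)\<close>, and the result combines two estimates on such integrals.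

  Upper bound. Multiplied by \<open>\<sigma>\<close>, the profile of a \<open>1\<close>-Lipschitz \<open>\<psi>\<close> is itself
  \<open>1\<close>-Lipschitz, so the easy half of Kantorovich--Rubinstein duality
  (\<open>lipschitz_integral_diff_le_W1\<close>) bounds the difference of two integrals by the transport
  distance divided by \<open>\<sigma>\<close>. With \<open>w = r * \<Delta> / 4\<close> and \<open>\<sigma> \<ge> r\<close> this is at most \<open>\<Delta> / 4\<close>.

  Lower bound. For \<open>r \<le> \<sigma> \<le> 2 * r\<close>, the profile of a kernel function is at least
  \<open>1 - \<delta>\<close> on the ball of radius \<open>r / p\<close> and at most \<open>\<delta>\<close> off the ball of radius
  \<open>4 * p * r\<close>. Hence a mass gap \<open>\<Delta>\<close> between the small ball for one measure and the large
  ball for the other survives in the integrals up to an error \<open>\<delta>\<close> times the two total masses,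
  that is up to \<open>2 * \<delta> * M \<le> \<Delta> / 2\<close> (\<open>kernel_integral_gap\<close>).\<close>

text \<open>Transporting the mass along a coupling writes the difference of the two integrals as one
  integral of \<open>f x - f y\<close>, whose absolute value is at most the transport cost. Integrability of
  \<open>f\<close> makes both integrals genuine; without it a divergent one would count as zero.\<close>

lemma lipschitz_integral_diff_le_W1:
  fixes f :: "'a::euclidean_space \<Rightarrow> real"
  assumes lip: "1-lipschitz_on UNIV f"
    and int: "integrable \<mu> f" "integrable \<nu> f"
  shows "ennreal \<bar>(\<integral>x. f x \<partial>\<mu>) - (\<integral>x. f x \<partial>\<nu>)\<bar> \<le> W1 \<mu> \<nu>"
  unfolding W1_def
proof (rule INF_greatest)
  fix \<pi> assume "\<pi> \<in> couplings \<mu> \<nu>"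
  then have [measurable_cong]: "sets \<pi> = sets borel"
    and marg: "distr \<pi> borel fst = \<mu>" "distr \<pi> borel snd = \<nu>"
    by (auto simp: couplings_def)
  have [measurable]: "fst \<in> borel_measurable (borel :: ('a \<times> 'a) measure)"
    "snd \<in> borel_measurable (borel :: ('a \<times> 'a) measure)"
    by (auto intro!: borel_measurable_continuous_onI continuous_intros)
  have [measurable]: "f \<in> borel_measurable borel"
    by (rule borel_measurable_continuous_onI) (rule lipschitz_on_continuous_on[OF lip])
  have i: "integrable \<pi> (\<lambda>z. f (fst z))" "integrable \<pi> (\<lambda>z. f (snd z))"
    using int unfolding marg[symmetric] by (simp_all add: integrable_distr_eq)
  have "(\<integral>x. f x \<partial>\<mu>) - (\<integral>x. f x \<partial>\<nu>) = (\<integral>z. f (fst z) - f (snd z) \<partial>\<pi>)"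
    using i unfolding marg[symmetric] by (simp add: integral_distr)
  then have "ennreal \<bar>(\<integral>x. f x \<partial>\<mu>) - (\<integral>x. f x \<partial>\<nu>)\<bar>
      \<le> (\<integral>\<^sup>+z. ennreal \<bar>f (fst z) - f (snd z)\<bar> \<partial>\<pi>)"
    using integral_norm_bound_ennreal[OF Bochner_Integration.integrable_diff[OF i]] by simp
  also have "\<dots> \<le> (\<integral>\<^sup>+z. ennreal (norm (fst z - snd z)) \<partial>\<pi>)"
  proof (intro nn_integral_mono ennreal_leI)
    fix z :: "'a \<times> 'a"
    show "\<bar>f (fst z) - f (snd z)\<bar> \<le> norm (fst z - snd z)"
      using lipschitz_onD[OF lip, of "fst z" "snd z"] by (simp add: dist_norm)
  qed
  finally show "ennreal \<bar>(\<integral>x. f x \<partial>\<mu>) - (\<integral>x. f x \<partial>\<nu>)\<bar>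
      \<le> (\<integral>\<^sup>+z. ennreal (norm (fst z - snd z)) \<partial>\<pi>)" .
qed

text \<open>The function may be unbounded on the whole space, but the compact ball carries all the
  mass.\<close>

lemma integrable_continuous_ball_measure:
  fixes f :: "'a::euclidean_space \<Rightarrow> real"
  assumes \<mu>: "\<mu> \<in> ball_measures R M" and cont: "continuous_on UNIV f"
  shows "integrable \<mu> f"
proof -
  have [measurable_cong]: "sets \<mu> = sets borel" and "finite_measure \<mu>"
    and null: "emeasure \<mu> (- cball 0 R) = 0"
    using \<mu> by (auto simp: ball_measures_def)
  interpret finite_measure \<mu> by fact
  have [measurable]: "f \<in> borel_measurable borel"
    using cont by (rule borel_measurable_continuous_onI)
  have "bounded (f ` cball 0 R)"
    by (intro compact_imp_bounded compact_continuous_image compact_cball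
          continuous_on_subset[OF cont]) simp
  then obtain B where B: "\<And>x. x \<in> cball 0 R \<Longrightarrow> norm (f x) \<le> B"
    unfolding bounded_iff by blast
  have "- cball 0 R \<in> null_sets \<mu>"
    using null by (auto intro!: null_setsI)
  then have "AE x in \<mu>. norm (f x) \<le> B"
    by (rule AE_I') (use B in auto)
  then show ?thesis
    by (rule integrable_const_bound) measurable
qed

text \<open>Rescaling the argument by \<open>1 / \<sigma>\<close> and the value by \<open>\<sigma>\<close> preserves the Lipschitz
  constant \<open>1\<close>, and so does composition with the distance to \<open>c\<close>.\<close>

lemma lipschitz_scaled_profile:
  fixes c :: "'a::real_normed_vector" and \<psi> :: "real \<Rightarrow> real"
  assumes lip: "1-lipschitz_on {0..} \<psi>" and "\<sigma> > 0"
  shows "1-lipschitz_on UNIV (\<lambda>u. \<sigma> * \<psi> (norm (u - c) / \<sigma>))"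
proof (rule lipschitz_onI)
  fix x y :: 'a
  have "\<bar>\<psi> (norm (x - c) / \<sigma>) - \<psi> (norm (y - c) / \<sigma>)\<bar>
      \<le> \<bar>norm (x - c) / \<sigma> - norm (y - c) / \<sigma>\<bar>"
    using lipschitz_onD[OF lip, of "norm (x - c) / \<sigma>" "norm (y - c) / \<sigma>"] \<open>\<sigma> > 0\<close>
    by (simp add: dist_real_def)
  also have "\<dots> = \<bar>norm (x - c) - norm (y - c)\<bar> / \<sigma>"
    using \<open>\<sigma> > 0\<close> by (simp flip: diff_divide_distrib)
  also have "\<dots> \<le> norm (x - y) / \<sigma>"
    using \<open>\<sigma> > 0\<close> norm_triangle_ineq3[of "x - c" "y - c"]
    by (intro divide_right_mono) auto
  finally have "\<sigma> * \<bar>\<psi> (norm (x - c) / \<sigma>) - \<psi> (norm (y - c) / \<sigma>)\<bar> \<le> norm (x - y)"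
    using \<open>\<sigma> > 0\<close> by (simp add: pos_le_divide_eq mult.commute)
  moreover have "\<bar>\<sigma> * \<psi> (norm (x - c) / \<sigma>) - \<sigma> * \<psi> (norm (y - c) / \<sigma>)\<bar>
      = \<sigma> * \<bar>\<psi> (norm (x - c) / \<sigma>) - \<psi> (norm (y - c) / \<sigma>)\<bar>"
    using \<open>\<sigma> > 0\<close> by (simp add: abs_mult flip: right_diff_distrib)
  ultimately show
    "dist (\<sigma> * \<psi> (norm (x - c) / \<sigma>)) (\<sigma> * \<psi> (norm (y - c) / \<sigma>)) \<le> 1 * dist x y"
    by (simp add: dist_real_def dist_norm)
qed simp

lemma integrable_profile:
  fixes c :: "'a::euclidean_space" and \<psi> :: "real \<Rightarrow> real"
  assumes "\<mu> \<in> ball_measures R M" and "1-lipschitz_on {0..} \<psi>" and "\<sigma> > 0"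
  shows "integrable \<mu> (\<lambda>u. \<psi> (norm (u - c) / \<sigma>))"
proof -
  have "integrable \<mu> (\<lambda>u. \<sigma> * \<psi> (norm (u - c) / \<sigma>))"
    using integrable_continuous_ball_measure[OF assms(1)]
      lipschitz_on_continuous_on[OF lipschitz_scaled_profile[OF assms(2,3)]] by blast
  with \<open>\<sigma> > 0\<close> show ?thesis by simp
qed

lemma profile_integral_diff_le:
  fixes c :: "'a::euclidean_space"
  assumes \<mu>\<nu>: "\<mu> \<in> ball_measures R M" "\<nu> \<in> ball_measures R M"
    and lip: "1-lipschitz_on {0..} \<psi>" and "\<sigma> > 0"
    and W1: "enn2ereal (W1 \<mu> \<nu>) \<le> ereal w"
  shows "\<bar>(\<integral>u. \<psi> (norm (u - c) / \<sigma>) \<partial>\<mu>) - (\<integral>u. \<psi> (norm (u - c) / \<sigma>) \<partial>\<nu>)\<bar> \<le> w / \<sigma>"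
    (is "\<bar>?a - ?b\<bar> \<le> _")
proof -
  have "ennreal \<bar>\<sigma> * ?a - \<sigma> * ?b\<bar> \<le> W1 \<mu> \<nu>"
    using lipschitz_integral_diff_le_W1[OF lipschitz_scaled_profile[OF lip \<open>\<sigma> > 0\<close>, of c]]
      integrable_profile[OF \<mu>\<nu>(1) lip \<open>\<sigma> > 0\<close>] integrable_profile[OF \<mu>\<nu>(2) lip \<open>\<sigma> > 0\<close>]
    by simp
  then have "ereal \<bar>\<sigma> * ?a - \<sigma> * ?b\<bar> \<le> enn2ereal (W1 \<mu> \<nu>)"
    by (metis abs_ge_zero enn2ereal_ennreal less_eq_ennreal.rep_eq)
  with W1 have "\<bar>\<sigma> * ?a - \<sigma> * ?b\<bar> \<le> w"
    using order_trans ereal_less_eq(3) by blast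
  moreover have "\<bar>\<sigma> * ?a - \<sigma> * ?b\<bar> = \<sigma> * \<bar>?a - ?b\<bar>"
    using \<open>\<sigma> > 0\<close> by (simp add: abs_mult flip: right_diff_distrib)
  ultimately show ?thesis
    using \<open>\<sigma> > 0\<close> by (simp add: pos_le_divide_eq mult.commute)
qed

text \<open>The indicators of the two balls sandwich the profile: it dominates \<open>1 - \<delta>\<close> on the small
  ball because \<open>\<sigma> \<ge> r\<close>, and it is at most \<open>1\<close> on the large ball and at most \<open>\<delta>\<close> off it
  because \<open>\<sigma> \<le> 2 * r\<close>.\<close>

lemma kernel_integral_gap:
  fixes c :: "'a::euclidean_space"
  assumes \<mu>: "\<mu> \<in> ball_measures R M" and \<nu>: "\<nu> \<in> ball_measures R M"
    and ker: "kernel_function p \<delta> \<psi>" and "r > 0" and \<sigma>: "r \<le> \<sigma>" "\<sigma> \<le> 2 * r"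
    and gap: "measure \<mu> (cball c (r / real p)) \<ge> measure \<nu> (cball c (4 * real p * r)) + \<Delta>"
  shows "\<Delta> - 2 * \<delta> * M
    \<le> (\<integral>u. \<psi> (norm (u - c) / \<sigma>) \<partial>\<mu>) - (\<integral>u. \<psi> (norm (u - c) / \<sigma>) \<partial>\<nu>)"
proof -
  let ?f = "\<lambda>u. \<psi> (norm (u - c) / \<sigma>)"
  let ?B = "cball c (r / real p)" and ?B' = "cball c (4 * real p * r)"
  have \<delta>: "0 \<le> \<delta>" and lip: "1-lipschitz_on {0..} \<psi>"
    and nonneg: "\<And>u. u \<ge> 0 \<Longrightarrow> 0 \<le> \<psi> u" and le1: "\<And>u. u \<ge> 0 \<Longrightarrow> \<psi> u \<le> 1"
    and near: "\<And>u. 0 \<le> u \<Longrightarrow> u \<le> 1 / real p \<Longrightarrow> 1 - \<delta> \<le> \<psi> u"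
    and far: "\<And>u. 2 * real p < u \<Longrightarrow> \<psi> u \<le> \<delta>"
    using ker by (auto simp: kernel_function_def)
  have "\<sigma> > 0" using \<open>r > 0\<close> \<sigma> by simp
  have s[measurable_cong]: "sets \<mu> = sets borel" "sets \<nu> = sets borel"
    and fin: "finite_measure \<mu>" "finite_measure \<nu>"
    and mass: "measure \<mu> UNIV \<le> M" "measure \<nu> UNIV \<le> M"
    using \<mu> \<nu> by (auto simp: ball_measures_def)
  interpret \<mu>: finite_measure \<mu> by fact
  interpret \<nu>: finite_measure \<nu> by fact
  have sp: "space \<mu> = UNIV" "space \<nu> = UNIV"
    using sets_eq_imp_space_eq[OF s(1)] sets_eq_imp_space_eq[OF s(2)] by auto

  have lower: "(1 - \<delta>) * indicator ?B u \<le> ?f u" for u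
  proof (cases "u \<in> ?B")
    case True
    then have "norm (u - c) / \<sigma> \<le> (r / real p) / r"
      using \<open>r > 0\<close> \<sigma> by (intro frac_le) (auto simp: dist_norm norm_minus_commute)
    then show ?thesis
      using True \<open>r > 0\<close> \<open>\<sigma> > 0\<close> near[of "norm (u - c) / \<sigma>"] by simp
  qed (use nonneg \<open>\<sigma> > 0\<close> in simp)
  have upper: "?f u \<le> indicator ?B' u + \<delta>" for u
  proof (cases "u \<in> ?B'")
    case True
    then show ?thesis using le1[of "norm (u - c) / \<sigma>"] \<delta> \<open>\<sigma> > 0\<close> by simp
  next
    case False
    have "2 * real p * \<sigma> \<le> 2 * real p * (2 * r)"
      using \<sigma> by (intro mult_left_mono) auto
    also have "\<dots> < norm (u - c)"
      using False by (simp add: dist_norm norm_minus_commute)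
    finally show ?thesis
      using far[of "norm (u - c) / \<sigma>"] False \<open>\<sigma> > 0\<close> by (simp add: field_simps)
  qed

  have "(1 - \<delta>) * measure \<mu> ?B = (\<integral>u. (1 - \<delta>) * indicator ?B u \<partial>\<mu>)"
    by simp
  also have "\<dots> \<le> (\<integral>u. ?f u \<partial>\<mu>)"
    by (intro integral_mono lower integrable_profile[OF \<mu> lip \<open>\<sigma> > 0\<close>])
      (auto simp: \<mu>.emeasure_finite less_top[symmetric])
  finally have a: "(1 - \<delta>) * measure \<mu> ?B \<le> (\<integral>u. ?f u \<partial>\<mu>)" .
  have ind: "integrable \<nu> (indicator ?B' :: 'a \<Rightarrow> real)"
    by (auto simp: \<nu>.emeasure_finite less_top[symmetric])
  have "(\<integral>u. ?f u \<partial>\<nu>) \<le> (\<integral>u. indicator ?B' u + \<delta> \<partial>\<nu>)"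
    using ind by (intro integral_mono upper integrable_profile[OF \<nu> lip \<open>\<sigma> > 0\<close>]) auto
  also have "\<dots> = measure \<nu> ?B' + \<delta> * measure \<nu> UNIV"
    using ind by (simp add: sp)
  finally have b: "(\<integral>u. ?f u \<partial>\<nu>) \<le> measure \<nu> ?B' + \<delta> * measure \<nu> UNIV" .
  have "measure \<mu> ?B \<le> M"
    using \<mu>.bounded_measure[of ?B] mass(1) sp by simp
  then have "\<delta> * measure \<mu> ?B \<le> \<delta> * M" "\<delta> * measure \<nu> UNIV \<le> \<delta> * M"
    using \<delta> mass by (auto intro: mult_left_mono)
  with a b gap show ?thesis by (simp add: algebra_simps)
qed

lemma infnorm_le_cart:
  fixes x :: "real ^ 'n"
  assumes "\<And>i. \<bar>x $ i\<bar> \<le> b"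
  shows "infnorm x \<le> b"
  unfolding infnorm_cart by (rule cSup_least) (use assms in auto)

theorem proposition5:
  fixes X :: "nat \<Rightarrow> 'a::euclidean_space measure"
    and Z :: "nat \<Rightarrow> nat"
    and n L :: nat
    and R M :: real
  assumes "\<forall>i\<in>{1..n}. X i \<in> ball_measures R M"
    and "\<forall>i\<in>{1..n}. Z i \<in> {1..L}"
  shows
    "(\<forall>(w::real) \<Psi> (c :: 'a ^ 'k) \<sigma>.
        concentrated w n X Z \<longrightarrow>
        (\<forall>u\<ge>0. 0 \<le> \<Psi> u) \<longrightarrow> 1-lipschitz_on {0..} \<Psi> \<longrightarrow>
        (\<forall>j. c $ j \<in> cball 0 R) \<longrightarrow> \<sigma> > 0 \<longrightarrow>
        (\<forall>i1\<in>{1..n}. \<forall>i2\<in>{1..n}. Z i1 = Z i2 \<longrightarrow>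
           infnorm (vectorization \<Psi> c \<sigma> (X i1) - vectorization \<Psi> c \<sigma> (X i2)) \<le> w / \<sigma>))
     \<and>
     (\<forall>(p::nat) (r::real) (\<Delta>::real) (c :: 'a ^ 'k) (\<delta>::real) \<Psi> \<sigma>.
        p \<ge> 1 \<longrightarrow> r > 0 \<longrightarrow> \<Delta> \<ge> 0 \<longrightarrow>
        (\<forall>j. c $ j \<in> cball 0 R) \<longrightarrow>
        shatters p r \<Delta> c n X Z \<longrightarrow>
        concentrated (r * \<Delta> / 4) n X Z \<longrightarrow>
        kernel_function p \<delta> \<Psi> \<longrightarrow> \<delta> \<le> \<Delta> / (4 * M) \<longrightarrow>
        \<sigma> \<in> {r..2 * r} \<longrightarrow>
        (\<forall>i1\<in>{1..n}. \<forall>i2\<in>{1..n}.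
           (Z i1 = Z i2 \<longrightarrow>
              infnorm (vectorization \<Psi> c \<sigma> (X i1) - vectorization \<Psi> c \<sigma> (X i2)) \<le> \<Delta> / 4) \<and>
           (Z i1 \<noteq> Z i2 \<longrightarrow>
              infnorm (vectorization \<Psi> c \<sigma> (X i1) - vectorization \<Psi> c \<sigma> (X i2)) \<ge> \<Delta> / 2)))"
proof -
  have X: "X i \<in> ball_measures R M" if "i \<in> {1..n}" for i
    using assms(1) that by blast

  have upper: "infnorm (vectorization \<Psi> c \<sigma> (X i1) - vectorization \<Psi> c \<sigma> (X i2)) \<le> w / \<sigma>"
    if "concentrated w n X Z" "1-lipschitz_on {0..} \<Psi>" "\<sigma> > 0"
      "i1 \<in> {1..n}" "i2 \<in> {1..n}" "Z i1 = Z i2"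
    for w \<sigma> \<Psi> i1 i2 and c :: "'a ^ 'k"
  proof (rule infnorm_le_cart)
    fix j
    have "enn2ereal (W1 (X i1) (X i2)) \<le> ereal w"
      using that unfolding concentrated_def by blast
    with that show "\<bar>(vectorization \<Psi> c \<sigma> (X i1) - vectorization \<Psi> c \<sigma> (X i2)) $ j\<bar> \<le> w / \<sigma>"
      using profile_integral_diff_le[OF X X, of i1 i2 \<Psi> \<sigma> w "c $ j"]
      by (simp add: vectorization_def)
  qed

  have same: "infnorm (vectorization \<Psi> c \<sigma> (X i1) - vectorization \<Psi> c \<sigma> (X i2)) \<le> \<Delta> / 4"
    if "r > 0" "\<Delta> \<ge> 0" "concentrated (r * \<Delta> / 4) n X Z" "kernel_function p \<delta> \<Psi>"
      "\<sigma> \<in> {r..2 * r}" "i1 \<in> {1..n}" "i2 \<in> {1..n}" "Z i1 = Z i2"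
    for p :: nat and r \<Delta> \<delta> \<sigma> \<Psi> i1 i2 and c :: "'a ^ 'k"
  proof -
    have "infnorm (vectorization \<Psi> c \<sigma> (X i1) - vectorization \<Psi> c \<sigma> (X i2))
        \<le> (r * \<Delta> / 4) / \<sigma>"
      using that by (intro upper) (auto simp: kernel_function_def)
    also have "\<dots> \<le> (r * \<Delta> / 4) / r"
      using that by (intro divide_left_mono) auto
    also have "\<dots> = \<Delta> / 4" using \<open>r > 0\<close> by simp
    finally show ?thesis .
  qed

  have different: "\<Delta> / 2 \<le> infnorm (vectorization \<Psi> c \<sigma> (X i1) - vectorization \<Psi> c \<sigma> (X i2))"
    if "r > 0" "\<Delta> \<ge> 0" and shat: "shatters p r \<Delta> c n X Z" and ker: "kernel_function p \<delta> \<Psi>"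
      and \<delta>: "\<delta> \<le> \<Delta> / (4 * M)"
      and \<sigma>: "\<sigma> \<in> {r..2 * r}" and i: "i1 \<in> {1..n}" "i2 \<in> {1..n}" and ne: "Z i1 \<noteq> Z i2"
    for p :: nat and r \<Delta> \<delta> \<sigma> \<Psi> i1 i2 and c :: "'a ^ 'k"
  proof -
    have "0 \<le> measure (X i1) UNIV" by simp
    also have "\<dots> \<le> M" using X[OF i(1)] by (simp add: ball_measures_def)
    finally have "0 \<le> M" .
    \<comment> \<open>For \<open>M = 0\<close> the quotient bounding \<open>\<delta>\<close> is \<open>0\<close> by convention, but the product form
      below holds trivially.\<close>
    then have err: "2 * \<delta> * M \<le> \<Delta> / 2"
      using \<delta> \<open>\<Delta> \<ge> 0\<close> by (cases "M = 0") (auto simp: field_simps)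
    obtain j where
      "measure (X i1) (cball (c $ j) (r / real p))
         \<ge> measure (X i2) (cball (c $ j) (4 * real p * r)) + \<Delta> \<or>
       measure (X i2) (cball (c $ j) (r / real p))
         \<ge> measure (X i1) (cball (c $ j) (4 * real p * r)) + \<Delta>"
      using shat i ne unfolding shatters_def by blast
    then have "\<Delta> - 2 * \<delta> * M
        \<le> \<bar>(vectorization \<Psi> c \<sigma> (X i1) - vectorization \<Psi> c \<sigma> (X i2)) $ j\<bar>"
    proof
      assume "measure (X i1) (cball (c $ j) (r / real p))
         \<ge> measure (X i2) (cball (c $ j) (4 * real p * r)) + \<Delta>"
      from kernel_integral_gap[OF X[OF i(1)] X[OF i(2)] ker \<open>r > 0\<close> _ _ this, of \<sigma>] \<sigma>
      show ?thesis by (simp add: vectorization_def)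
    next
      assume "measure (X i2) (cball (c $ j) (r / real p))
         \<ge> measure (X i1) (cball (c $ j) (4 * real p * r)) + \<Delta>"
      from kernel_integral_gap[OF X[OF i(2)] X[OF i(1)] ker \<open>r > 0\<close> _ _ this, of \<sigma>] \<sigma>
      show ?thesis by (simp add: vectorization_def)
    qed
    also have "\<dots> \<le> infnorm (vectorization \<Psi> c \<sigma> (X i1) - vectorization \<Psi> c \<sigma> (X i2))"
      by (rule component_le_infnorm_cart)
    finally show ?thesis
      using err by simp
  qed

  show ?thesis
  proof (intro conjI allI impI ballI, goal_cases)
    case 1
    show ?case by (rule upper[OF 1(1,3,5-8)])
  next
    case 2
    show ?case by (rule same[OF 2(2,3,6,7,9-12)])
  next
    case 3
    show ?case by (rule different[OF 3(2,3,5,7-12)])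
  qed
qed

end
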